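(* Let $K$ be a compact Hausdorff space and let $C(K)$ be the Banach space of continuous real-valued functions on $K$ with the norm $\|f\|_\infty=\max\{|f(x)|:x\in K\}$. The following are equivalent: (1) $C(K)$ admits an equivalent norm that is uniformly rotund in every direction (URED); (2) $K$ supports a strictly positive measure.
   Context: A norm $\|\cdot\|$ on a real vector space $X$ is URED (uniformly rotund in every direction) if whenever $(x_n)_n$ and $(y_n)_n$ are sequences in $X$ such that (i) $\|x_n\|=\|y_n\|=1$ for all $n$, (ii) $\lim_n\left\|\frac{x_n+y_n}{2}\right\|=1$, and (iii) there exist $z\in X$ and scalars $r_n$ with $x_n-y_n=r_nz$ for all $n$, then $\lim_n\|x_n-y_n\|=0$. $K$ supports a strictly positive measure if there is a finite measure $\mu$ on the Borel $\sigma$-algebra of $K$ such that $\mu(G)>0$ for every nonempty open set $G\subset K$. *)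

theory Defs
  imports "HOL-Analysis.Analysis"
begin

definition is_norm :: "('a::real_vector \<Rightarrow> real) \<Rightarrow> bool" where
  "is_norm N \<longleftrightarrow>
     (\<forall>x. 0 \<le> N x) \<and>
     (\<forall>x. N x = 0 \<longleftrightarrow> x = 0) \<and>
     (\<forall>a x. N (a *\<^sub>R x) = \<bar>a\<bar> * N x) \<and>
     (\<forall>x y. N (x + y) \<le> N x + N y)"

definition equivalent_norm :: "('a::real_normed_vector \<Rightarrow> real) \<Rightarrow> bool" where
  "equivalent_norm N \<longleftrightarrow>
     is_norm N \<and> (\<exists>c C. 0 < c \<and> 0 < C \<and> (\<forall>x. c * norm x \<le> N x \<and> N x \<le> C * norm x))"

definition URED :: "('a::real_vector \<Rightarrow> real) \<Rightarrow> bool" where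
  "URED N \<longleftrightarrow>
     (\<forall>x y :: nat \<Rightarrow> 'a.
        (\<forall>n. N (x n) = 1 \<and> N (y n) = 1) \<and>
        (\<lambda>n. N ((1/2) *\<^sub>R (x n + y n))) \<longlonglongrightarrow> 1 \<and>
        (\<exists>z r. \<forall>n. x n - y n = r n *\<^sub>R z)
        \<longrightarrow> (\<lambda>n. N (x n - y n)) \<longlonglongrightarrow> 0)"

definition supports_strictly_positive_measure :: "'k::topological_space itself \<Rightarrow> bool" where
  "supports_strictly_positive_measure _ \<longleftrightarrow>
     (\<exists>\<mu> :: 'k measure. sets \<mu> = sets borel \<and> finite_measure \<mu> \<and>
        (\<forall>G. open G \<and> G \<noteq> {} \<longrightarrow> measure \<mu> G > 0))"

text \<open>For a compact space \<open>'k\<close>, the type \<open>'k \<Rightarrow>\<^sub>C real\<close> of bounded continuous functions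
  consists of all continuous functions, and its norm is the maximum norm.\<close>

lemma bcontfun_compact:
  assumes "compact (UNIV :: 'k::topological_space set)"
  shows "(bcontfun :: ('k \<Rightarrow> real) set) = {f. continuous_on UNIV f}"
  using assms by (auto simp: bcontfun_def intro: compact_imp_bounded compact_continuous_image)

lemma norm_bcontfun_compact:
  fixes f :: "'k::topological_space \<Rightarrow>\<^sub>C real"
  assumes "compact (UNIV :: 'k set)"
  shows "\<exists>x. \<bar>apply_bcontfun f x\<bar> = norm f \<and> (\<forall>y. \<bar>apply_bcontfun f y\<bar> \<le> norm f)"
proof -
  have "continuous_on UNIV (\<lambda>x. \<bar>apply_bcontfun f x\<bar>)"
    by (intro continuous_intros) auto
  then obtain x where x: "\<And>y. \<bar>apply_bcontfun f y\<bar> \<le> \<bar>apply_bcontfun f x\<bar>"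
    using continuous_attains_sup[OF assms] by blast
  have "norm f \<le> \<bar>apply_bcontfun f x\<bar>"
    using x by (intro norm_bound) auto
  moreover have "\<bar>apply_bcontfun f y\<bar> \<le> norm f" for y
    using norm_bounded[of f y] by simp
  ultimately show ?thesis
    by (metis order_antisym)
qed

end

theory Submission
  imports Defs
begin

text \<open>
  The norm is constructed from a strictly positive measure \<open>M\<close> as the square root of
  \<open>\<parallel>f\<parallel>\<^sup>2 + \<integral> f\<^sup>2 dM\<close>. The \<open>L\<^sup>2\<close> part obeys the parallelogram law and does not vanish on any
  nonzero \<open>z\<close>; so a sequence of segments \<open>r n *\<^sub>R z\<close> whose endpoints lie on the sphere and whose
  midpoints approach it must have \<open>r n\<close> tending to \<open>0\<close> (\<open>URED_sup_L2\<close>).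

  Conversely, let \<open>N\<close> be an equivalent URED norm. It suffices to find a positive linear functional \<open>L\<close>
  on the continuous functions that is strictly positive on nonzero functions \<open>g \<ge> 0\<close>, since the
  construction of Riesz and Markov turns \<open>L\<close> into a measure that is at least \<open>L g\<close> on any open set
  outside which \<open>g \<le> 1\<close> vanishes (\<open>positive_functional_measure\<close>). The functional comes from the
  multiplicative structure of the function space. Let \<open>a\<close> be the supremum of \<open>N\<close> on the unit ball of
  the sup norm and let \<open>x\<close> almost attain it. For \<open>0 \<le> g \<le> 1\<close> both \<open>x (1 - g) + g\<close> and
  \<open>x (1 - g) - g\<close> are again in the unit ball, so \<open>N\<close> is at most \<open>a\<close> there. Rotundity in the direction
  \<open>g\<close> then makes \<open>N (x (1 - g))\<close> smaller than \<open>a\<close> by an amount \<open>d > 0\<close> that depends on \<open>g\<close> but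
  not on \<open>x\<close> (\<open>URED_midpoint_drop\<close>). Hence multiplying an almost maximal \<open>x\<close> by \<open>1 - g\<close> costs
  at least \<open>d\<close>, and a Hahn-Banach argument makes this cost linear in \<open>g\<close>
  (\<open>URED_imp_strictly_positive_functional\<close>).
\<close>

section \<open>Norms given as functions\<close>

lemma
  assumes "is_norm N"
  shows is_norm_nonneg: "0 \<le> N x"
    and is_norm_eq_zero: "N x = 0 \<longleftrightarrow> x = 0"
    and is_norm_scaleR: "N (a *\<^sub>R x) = \<bar>a\<bar> * N x"
    and is_norm_triangle: "N (x + y) \<le> N x + N y"
  using assms by (simp_all add: is_norm_def)

lemma is_norm_pos: "is_norm N \<Longrightarrow> x \<noteq> 0 \<Longrightarrow> 0 < N x"
  using is_norm_nonneg[of N x] is_norm_eq_zero[of N x] by linarith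

lemma is_norm_minus: "is_norm N \<Longrightarrow> N (- x) = N x"
  using is_norm_scaleR[of N "-1" x] by simp

lemma is_norm_diff_le: "is_norm N \<Longrightarrow> N x - N y \<le> N (x - y)"
  using is_norm_triangle[of N "x - y" y] by simp

text \<open>The triangle inequality for \<open>N\<close> is the convexity of its unit ball, applied to the unit vectors
  \<open>x / N x\<close> and \<open>y / N y\<close> with weights proportional to \<open>N x\<close> and \<open>N y\<close>. For a norm whose square is
  a sum of squares of seminorms this convexity is immediate.\<close>

lemma minkowski_gauge:
  fixes N :: "'a::real_vector \<Rightarrow> real"
  assumes pos: "\<And>x. x \<noteq> 0 \<Longrightarrow> 0 < N x"
    and hom: "\<And>a x. N (a *\<^sub>R x) = \<bar>a\<bar> * N x"
    and convex: "\<And>x y t. N x = 1 \<Longrightarrow> N y = 1 \<Longrightarrow> 0 \<le> t \<Longrightarrow> t \<le> 1 \<Longrightarrow> N (t *\<^sub>R x + (1 - t) *\<^sub>R y) \<le> 1"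
  shows "is_norm N"
proof -
  have zero: "N 0 = 0"
    using hom[of 0 0] by simp
  have "N (x + y) \<le> N x + N y" for x y
  proof (cases "x = 0 \<or> y = 0")
    case True
    then show ?thesis using zero by auto
  next
    case False
    define a b where "a = N x" and "b = N y"
    have ab: "a > 0" "b > 0"
      using False pos by (auto simp: a_def b_def)
    have "N ((1/a) *\<^sub>R x) = 1" "N ((1/b) *\<^sub>R y) = 1"
      using ab by (auto simp: hom simp flip: a_def b_def)
    then have *: "N ((a/(a+b)) *\<^sub>R ((1/a) *\<^sub>R x) + (1 - a/(a+b)) *\<^sub>R ((1/b) *\<^sub>R y)) \<le> 1"
      using ab by (intro convex) auto
    have "1 - a/(a+b) = b/(a+b)"
      using ab by (simp add: field_simps)
    then have "(a/(a+b)) *\<^sub>R ((1/a) *\<^sub>R x) + (1 - a/(a+b)) *\<^sub>R ((1/b) *\<^sub>R y) = (1/(a+b)) *\<^sub>R (x + y)"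
      using ab by (simp add: scaleR_add_right)
    with * have "N (x + y) / (a + b) \<le> 1"
      using ab by (simp add: hom)
    then show ?thesis
      using ab by (simp add: a_def b_def divide_le_eq split: if_splits)
  qed
  moreover have "0 \<le> N x" for x
    using pos[of x] zero by (cases "x = 0") auto
  ultimately show ?thesis
    unfolding is_norm_def using pos hom zero by (metis less_irrefl)
qed

section \<open>A norm from a strictly positive measure\<close>

context
  fixes M :: "'k::topological_space measure"
  assumes sets_M: "sets M = sets borel" and fin: "finite_measure M"
begin

lemma integrable_continuous_bounded:
  assumes "continuous_on UNIV (h :: 'k \<Rightarrow> real)" "\<And>t. \<bar>h t\<bar> \<le> b"
  shows "integrable M h"
proof (rule finite_measure.integrable_const_bound[OF fin])
  show "AE t in M. norm (h t) \<le> b" using assms(2) by simp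
  have "h \<in> borel_measurable borel"
    using assms(1) by (rule borel_measurable_continuous_onI)
  then show "h \<in> borel_measurable M"
    using measurable_cong_sets[OF sets_M refl] by blast
qed

lemma bc_square_le: "\<bar>(f t)\<^sup>2\<bar> \<le> (norm f)\<^sup>2" for f :: "'k \<Rightarrow>\<^sub>C real"
  using power_mono[OF norm_bounded[of f t] norm_ge_zero, of 2] by simp

lemma integrable_bc_square: "integrable M (\<lambda>t. (f t)\<^sup>2)" for f :: "'k \<Rightarrow>\<^sub>C real"
  by (rule integrable_continuous_bounded[OF _ bc_square_le]) (intro continuous_intros, simp)

definition sq_int :: "('k \<Rightarrow>\<^sub>C real) \<Rightarrow> real" where
  "sq_int f = (\<integral>t. (f t)\<^sup>2 \<partial>M)"

text \<open>The sup part makes the norm equivalent to the given one, the \<open>L\<^sup>2\<close> part makes it rotund.\<close>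

definition sup_L2_norm :: "('k \<Rightarrow>\<^sub>C real) \<Rightarrow> real" where
  "sup_L2_norm f = sqrt ((norm f)\<^sup>2 + sq_int f)"

lemma sq_int_nonneg: "0 \<le> sq_int f"
  by (simp add: sq_int_def)

lemma sq_int_le: "sq_int f \<le> (norm f)\<^sup>2 * measure M UNIV"
proof -
  have "sq_int f \<le> (\<integral>t. (norm f)\<^sup>2 \<partial>M)"
    unfolding sq_int_def using bc_square_le[of f]
    by (intro integral_mono integrable_bc_square finite_measure.integrable_const[OF fin]) (simp add: abs_le_iff)
  also have "\<dots> = (norm f)\<^sup>2 * measure M UNIV"
    using sets_eq_imp_space_eq[OF sets_M] by simp
  finally show ?thesis .
qed

lemma sq_int_scaleR: "sq_int (c *\<^sub>R f) = c\<^sup>2 * sq_int f"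
  by (simp add: sq_int_def power_mult_distrib)

text \<open>The parallelogram law, for an arbitrary point of a segment. The subtracted term is what makes
  the norm below rotund; at \<open>s = 1/2\<close> it is a quarter of the squared distance.\<close>

lemma sq_int_convex_identity:
  "sq_int (s *\<^sub>R f + (1 - s) *\<^sub>R g) = s * sq_int f + (1 - s) * sq_int g - s * (1 - s) * sq_int (f - g)"
proof -
  have lincomb: "(\<integral>t. a * F t + b * G t - c * H t \<partial>M)
      = a * (\<integral>t. F t \<partial>M) + b * (\<integral>t. G t \<partial>M) - c * (\<integral>t. H t \<partial>M)"
    if "integrable M F" "integrable M G" "integrable M H" for a b c :: real and F G H :: "'k \<Rightarrow> real"
    using that by simp
  have "sq_int (s *\<^sub>R f + (1 - s) *\<^sub>R g)
      = (\<integral>t. s * (f t)\<^sup>2 + (1 - s) * (g t)\<^sup>2 - s * (1 - s) * ((f - g) t)\<^sup>2 \<partial>M)"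
    unfolding sq_int_def by (intro Bochner_Integration.integral_cong refl) (simp add: power2_eq_square algebra_simps)
  also have "\<dots> = s * sq_int f + (1 - s) * sq_int g - s * (1 - s) * sq_int (f - g)"
    unfolding sq_int_def by (rule lincomb) (rule integrable_bc_square)+
  finally show ?thesis .
qed

lemma norm_square_convex:
  fixes f g :: "'v::real_normed_vector"
  assumes "0 \<le> s" "s \<le> 1"
  shows "(norm (s *\<^sub>R f + (1 - s) *\<^sub>R g))\<^sup>2 \<le> s * (norm f)\<^sup>2 + (1 - s) * (norm g)\<^sup>2"
proof -
  have "norm (s *\<^sub>R f + (1 - s) *\<^sub>R g) \<le> s * norm f + (1 - s) * norm g"
    using norm_triangle_ineq[of "s *\<^sub>R f" "(1 - s) *\<^sub>R g"] assms by simp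
  then have "(norm (s *\<^sub>R f + (1 - s) *\<^sub>R g))\<^sup>2 \<le> (s * norm f + (1 - s) * norm g)\<^sup>2"
    by (intro power_mono) auto
  also have "\<dots> = s * (norm f)\<^sup>2 + (1 - s) * (norm g)\<^sup>2 - s * (1 - s) * (norm f - norm g)\<^sup>2"
    by (simp add: power2_eq_square algebra_simps)
  also have "\<dots> \<le> s * (norm f)\<^sup>2 + (1 - s) * (norm g)\<^sup>2"
    using assms by simp
  finally show ?thesis .
qed

lemma sup_L2_square: "(sup_L2_norm f)\<^sup>2 = (norm f)\<^sup>2 + sq_int f"
  using sq_int_nonneg by (simp add: sup_L2_norm_def)

lemma sup_L2_square_convex:
  assumes "0 \<le> s" "s \<le> 1"
  shows "(sup_L2_norm (s *\<^sub>R f + (1 - s) *\<^sub>R g))\<^sup>2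
    \<le> s * (sup_L2_norm f)\<^sup>2 + (1 - s) * (sup_L2_norm g)\<^sup>2 - s * (1 - s) * sq_int (f - g)"
  using norm_square_convex[OF assms, of f g]
  unfolding sup_L2_square sq_int_convex_identity by (simp add: distrib_left)

lemma norm_le_sup_L2: "norm f \<le> sup_L2_norm f"
  unfolding sup_L2_norm_def using sq_int_nonneg by (intro real_le_rsqrt) simp

lemma sup_L2_scaleR: "sup_L2_norm (c *\<^sub>R f) = \<bar>c\<bar> * sup_L2_norm f"
proof -
  have "(norm (c *\<^sub>R f))\<^sup>2 + sq_int (c *\<^sub>R f) = c\<^sup>2 * ((norm f)\<^sup>2 + sq_int f)"
    by (simp add: sq_int_scaleR power_mult_distrib algebra_simps)
  then show ?thesis by (simp add: sup_L2_norm_def real_sqrt_mult)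
qed

lemma is_norm_sup_L2: "is_norm sup_L2_norm"
proof (rule minkowski_gauge)
  show "0 < sup_L2_norm f" if "f \<noteq> 0" for f
    using norm_le_sup_L2[of f] zero_less_norm_iff[of f] that by linarith
  show "sup_L2_norm (a *\<^sub>R f) = \<bar>a\<bar> * sup_L2_norm f" for a f
    by (rule sup_L2_scaleR)
  fix f g t assume fg: "sup_L2_norm f = 1" "sup_L2_norm g = 1" and t: "0 \<le> t" "t \<le> (1::real)"
  have "0 \<le> t * (1 - t) * sq_int (f - g)" using t sq_int_nonneg by simp
  then have "(sup_L2_norm (t *\<^sub>R f + (1 - t) *\<^sub>R g))\<^sup>2 \<le> 1\<^sup>2"
    using sup_L2_square_convex[OF t, of f g] by (simp add: fg)
  then show "sup_L2_norm (t *\<^sub>R f + (1 - t) *\<^sub>R g) \<le> 1"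
    by (rule power2_le_imp_le) simp
qed

lemma equivalent_norm_sup_L2: "equivalent_norm sup_L2_norm"
proof -
  define C where "C = sqrt (1 + measure M UNIV)"
  have "sup_L2_norm f \<le> C * norm f" for f
  proof -
    have "sup_L2_norm f \<le> sqrt ((1 + measure M UNIV) * (norm f)\<^sup>2)"
      unfolding sup_L2_norm_def using sq_int_le[of f] by (intro real_sqrt_le_mono) (simp add: algebra_simps)
    also have "\<dots> = C * norm f" by (simp add: C_def real_sqrt_mult)
    finally show ?thesis .
  qed
  moreover have "0 < C" by (simp add: C_def add_pos_nonneg)
  ultimately show ?thesis
    unfolding equivalent_norm_def using is_norm_sup_L2 norm_le_sup_L2
    by (intro conjI exI[of _ 1] exI[of _ C]) auto
qed

lemma sq_int_pos:
  assumes strict: "\<And>G. open G \<Longrightarrow> G \<noteq> {} \<Longrightarrow> 0 < measure M G" and "z \<noteq> 0"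
  shows "0 < sq_int z"
proof -
  obtain t0 where t0: "z t0 \<noteq> 0"
    using \<open>z \<noteq> 0\<close> bcontfun_eqI[of z 0] by auto
  define e where "e = (z t0)\<^sup>2 / 2"
  have e: "0 < e" using t0 by (simp add: e_def)
  define G where "G = {t. e < (z t)\<^sup>2}"
  have G: "open G"
    unfolding G_def by (intro open_Collect_less continuous_intros) auto
  then have GM: "G \<in> sets M" by (simp add: sets_M)
  have "t0 \<in> G" using t0 by (simp add: G_def e_def)
  then have "0 < measure M G" by (intro strict[OF G]) blast
  with e have "0 < e * measure M G" by (rule mult_pos_pos)
  also have "\<dots> = (\<integral>t. e * indicator G t \<partial>M)"
    using GM sets_eq_imp_space_eq[OF sets_M] by simp
  also have "\<dots> \<le> sq_int z"
    unfolding sq_int_def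
  proof (intro integral_mono integrable_bc_square)
    show "integrable M (\<lambda>t. e * indicator G t)"
      using GM finite_measure.emeasure_finite[OF fin, of G]
      by (intro integrable_mult_right integrable_real_indicator) (auto simp: less_top)
    show "e * indicator G t \<le> (z t)\<^sup>2" for t
      using e by (auto simp: G_def indicator_def)
  qed
  finally show ?thesis .
qed

text \<open>If the midpoints of \<open>x n\<close> and \<open>y n\<close> approach the unit sphere, the parallelogram law forces the
  \<open>L\<^sup>2\<close> distance of \<open>x n\<close> and \<open>y n\<close> to \<open>0\<close>. In general this says nothing about the sup norm; but
  here the difference is \<open>r n\<close> times a fixed \<open>z\<close>, and \<open>z\<close> has positive \<open>L\<^sup>2\<close> norm since the measure
  charges every nonempty open set. So \<open>r n\<close> tends to \<open>0\<close>.\<close>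

lemma URED_sup_L2:
  assumes strict: "\<And>G. open G \<Longrightarrow> G \<noteq> {} \<Longrightarrow> 0 < measure M G"
  shows "URED sup_L2_norm"
  unfolding URED_def
proof (intro allI impI, elim conjE exE)
  fix x y :: "nat \<Rightarrow> 'k \<Rightarrow>\<^sub>C real" and z r
  assume unit: "\<forall>n. sup_L2_norm (x n) = 1 \<and> sup_L2_norm (y n) = 1"
    and mid: "(\<lambda>n. sup_L2_norm ((1/2) *\<^sub>R (x n + y n))) \<longlonglongrightarrow> 1"
    and r: "\<forall>n. x n - y n = r n *\<^sub>R z"
  show "(\<lambda>n. sup_L2_norm (x n - y n)) \<longlonglongrightarrow> 0"
  proof (cases "z = 0")
    case True
    then show ?thesis using r is_norm_eq_zero[OF is_norm_sup_L2, of 0] by simp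
  next
    case False
    have z: "0 < sq_int z"
      by (rule sq_int_pos) (use strict False in auto)
    let ?m = "\<lambda>n. (sup_L2_norm ((1/2) *\<^sub>R (x n + y n)))\<^sup>2"
    \<comment> \<open>the convexity estimate at 1/2, solved for \<open>r n\<close>\<close>
    have bound: "(r n)\<^sup>2 \<le> 4 * (1 - ?m n) / sq_int z" for n
    proof -
      have "?m n \<le> 1 - (r n)\<^sup>2 * sq_int z / 4"
        using sup_L2_square_convex[of "1/2" "x n" "y n"] unit r
        by (simp add: sq_int_scaleR scaleR_add_right)
      then show ?thesis using z by (simp add: pos_le_divide_eq)
    qed
    have "(\<lambda>n. 4 * (1 - ?m n) / sq_int z) \<longlonglongrightarrow> 4 * (1 - 1\<^sup>2) / sq_int z"
      using z by (intro tendsto_intros mid) auto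
    then have lim: "(\<lambda>n. 4 * (1 - ?m n) / sq_int z) \<longlonglongrightarrow> 0"
      by simp
    have "(\<lambda>n. (r n)\<^sup>2) \<longlonglongrightarrow> 0"
      by (rule tendsto_sandwich[OF _ always_eventually[OF allI[OF bound]] tendsto_const lim]) simp
    then have "(\<lambda>n. sqrt ((r n)\<^sup>2)) \<longlonglongrightarrow> sqrt 0"
      by (rule tendsto_real_sqrt)
    then have "(\<lambda>n. \<bar>r n\<bar> * sup_L2_norm z) \<longlonglongrightarrow> 0"
      using tendsto_mult_right[of "\<lambda>n. \<bar>r n\<bar>" 0 sequentially "sup_L2_norm z"] by simp
    then show ?thesis using r by (simp add: sup_L2_scaleR)
  qed
qed

end

section \<open>Rotundity in a direction, quantitatively\<close>

text \<open>Used to turn points that lie only inside a ball into points on its sphere, as the definition of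
  \<open>URED\<close> asks for: going from \<open>x + z\<close> further in the direction \<open>z\<close> one leaves the ball eventually.
  The last property bounds the distance that this takes.\<close>

lemma is_norm_reach:
  assumes N: "is_norm N" and "z \<noteq> 0" and le: "N (x + z) \<le> a"
  obtains t where "1 \<le> t" "N (x + t *\<^sub>R z) = a" "t * N z \<le> N x + a"
proof -
  have z: "N z > 0"
    using N \<open>z \<noteq> 0\<close> by (rule is_norm_pos)
  have lip: "\<bar>N (x + s *\<^sub>R z) - N (x + t *\<^sub>R z)\<bar> \<le> N z * \<bar>s - t\<bar>" for s t
  proof -
    have "N ((x + s *\<^sub>R z) - (x + t *\<^sub>R z)) = N z * \<bar>s - t\<bar>"
      "N ((x + t *\<^sub>R z) - (x + s *\<^sub>R z)) = N z * \<bar>s - t\<bar>"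
      by (simp_all add: is_norm_scaleR[OF N] mult.commute abs_minus_commute flip: scaleR_diff_left)
    then show ?thesis
      using is_norm_diff_le[OF N, of "x + s *\<^sub>R z" "x + t *\<^sub>R z"]
        is_norm_diff_le[OF N, of "x + t *\<^sub>R z" "x + s *\<^sub>R z"] by (simp add: abs_le_iff)
  qed
  have "(N z)-lipschitz_on UNIV (\<lambda>t. N (x + t *\<^sub>R z))"
    using lip z by (intro lipschitz_onI) (auto simp: dist_real_def)
  then have cont: "continuous_on A (\<lambda>t. N (x + t *\<^sub>R z))" for A
    by (meson continuous_on_subset lipschitz_on_continuous_on subset_UNIV)
  define T where "T = max 1 ((N x + a) / N z)"
  have "(N x + a) / N z \<le> T" by (simp add: T_def)
  then have "N x + a \<le> T * N z"
    using z by (simp add: divide_le_eq)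
  also have "T * N z = N (T *\<^sub>R z)"
    by (simp add: is_norm_scaleR[OF N] T_def)
  also have "\<dots> \<le> N (x + T *\<^sub>R z) + N x"
    using is_norm_diff_le[OF N, of "T *\<^sub>R z" "- x"] by (simp add: is_norm_minus[OF N] add.commute)
  finally have "a \<le> N (x + T *\<^sub>R z)" by simp
  then obtain t where t: "1 \<le> t" "N (x + t *\<^sub>R z) = a"
    using IVT'[of "\<lambda>t. N (x + t *\<^sub>R z)" 1 a T] le cont by (auto simp: T_def)
  have "t * N z = N (t *\<^sub>R z)"
    using t by (simp add: is_norm_scaleR[OF N])
  also have "\<dots> \<le> N (x + t *\<^sub>R z) + N x"
    using is_norm_diff_le[OF N, of "t *\<^sub>R z" "- x"] by (simp add: is_norm_minus[OF N] add.commute)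
  finally show thesis
    using that t by simp
qed

text \<open>A chord with endpoints on the sphere of radius \<open>a\<close> passes through \<open>x\<close>. If \<open>x\<close> is close to the
  sphere, then so is the midpoint, provided that \<open>x\<close> divides the chord in a bounded ratio: \<open>x\<close> is a
  convex combination of the midpoint and one endpoint, and the midpoint has a weight bounded below
  in it.\<close>

lemma is_norm_chord_midpoint:
  assumes N: "is_norm N"
    and p: "N (x + t *\<^sub>R z) = a" and q: "N (x - s *\<^sub>R z) = a"
    and s: "1 \<le> s" "s \<le> R" and t: "1 \<le> t" "t \<le> R" and x: "N x \<le> a"
  shows "a - N ((1/2) *\<^sub>R ((x + t *\<^sub>R z) + (x - s *\<^sub>R z))) \<le> R * (a - N x)"
  using p q s t
proof (induction s t arbitrary: z rule: linorder_wlog)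
  case (le s t)
  define m where "m = (t - s) / 2"
  have m: "0 \<le> m" using le by (simp add: m_def)
  let ?mid = "(1/2) *\<^sub>R ((x + t *\<^sub>R z) + (x - s *\<^sub>R z))"
  have mid: "?mid = x + m *\<^sub>R z"
  proof -
    have "?mid = (1/2 + 1/2) *\<^sub>R x + (t/2 - s/2) *\<^sub>R z"
      by (simp only: scaleR_add_left scaleR_diff_left) (simp add: algebra_simps)
    then show ?thesis by (simp add: m_def diff_divide_distrib)
  qed
  \<comment> \<open>up to the factor \<open>m + s\<close>, the convex combination mentioned above\<close>
  have "(m + s) *\<^sub>R x = s *\<^sub>R ?mid + m *\<^sub>R (x - s *\<^sub>R z)"
    unfolding mid by (simp add: algebra_simps)
  then have "N ((m + s) *\<^sub>R x) \<le> N (s *\<^sub>R ?mid) + N (m *\<^sub>R (x - s *\<^sub>R z))"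
    using is_norm_triangle[OF N] by metis
  then have "(m + s) * N x \<le> s * N ?mid + m * a"
    using le m by (simp add: is_norm_scaleR[OF N])
  then have "s * (a - N ?mid) \<le> (m + s) * (a - N x)"
    by (simp add: algebra_simps)
  moreover have "m + s \<le> R"
    using le by (simp add: m_def field_simps)
  then have "(m + s) * (a - N x) \<le> R * (a - N x)"
    using x by (intro mult_right_mono) auto
  ultimately have *: "s * (a - N ?mid) \<le> R * (a - N x)"
    by linarith
  have "0 \<le> a - N ?mid"
    using is_norm_triangle[OF N, of "x + t *\<^sub>R z" "x - s *\<^sub>R z"] le
    by (simp only: is_norm_scaleR[OF N])
  then have "1 * (a - N ?mid) \<le> s * (a - N ?mid)"
    using le by (intro mult_right_mono) auto
  with * show ?case by simp
next
  case (sym s t)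
  from sym.IH[of "- z"] sym.prems show ?case
    by (simp add: add.commute)
qed

text \<open>The quantitative form of rotundity in the direction \<open>z\<close>: the drop \<open>d\<close> depends on \<open>z\<close> and the
  radius but not on the centre \<open>x\<close>. Otherwise there would be centres \<open>x n\<close> whose norms tend to \<open>a\<close>;
  prolonging the segments \<open>x n - z\<close>, \<open>x n + z\<close> to chords of the sphere would give two sequences on
  the sphere, with differences parallel to \<open>z\<close> and not small, whose midpoints approach the
  sphere.\<close>

lemma URED_midpoint_drop:
  assumes N: "is_norm N" and "URED N" and z: "z \<noteq> 0" and a: "0 < a"
  obtains d where "0 < d" "\<And>x. N (x + z) \<le> a \<Longrightarrow> N (x - z) \<le> a \<Longrightarrow> N x \<le> a - d"
proof (rule ccontr)
  assume "\<not> thesis"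
  with that have "\<not> (0 < d \<and> (\<forall>x. N (x + z) \<le> a \<longrightarrow> N (x - z) \<le> a \<longrightarrow> N x \<le> a - d))" for d
    by blast
  then have "\<exists>x. N (x + z) \<le> a \<and> N (x - z) \<le> a \<and> a - d < N x" if "0 < d" for d
    using \<open>0 < d\<close> by (meson linorder_not_le)
  then have "\<forall>n. \<exists>x. N (x + z) \<le> a \<and> N (x - z) \<le> a \<and> a - inverse (real (Suc n)) < N x"
    by simp
  then obtain x where x: "\<And>n. N (x n + z) \<le> a" "\<And>n. N (x n - z) \<le> a"
      "\<And>n. a - inverse (real (Suc n)) < N (x n)"
    by metis
  have Nz: "N z > 0" by (rule is_norm_pos[OF N z])
  have x_le: "N (x n) \<le> a" for n
  proof -
    have "2 * N (x n) = N ((x n + z) + (x n - z))"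
      using is_norm_scaleR[OF N, of 2 "x n"] by (simp add: scaleR_2)
    also have "\<dots> \<le> a + a"
      using is_norm_triangle[OF N, of "x n + z" "x n - z"] x(1,2)[of n] by simp
    finally show ?thesis by simp
  qed
  define R where "R = 2 * a / N z"
  have "\<exists>t. 1 \<le> t \<and> t \<le> R \<and> N (x n + t *\<^sub>R z) = a" for n
  proof -
    obtain t where "1 \<le> t" "N (x n + t *\<^sub>R z) = a" "t * N z \<le> N (x n) + a"
      using is_norm_reach[OF N z x(1)] by blast
    with x_le[of n] Nz show ?thesis
      by (intro exI[of _ t]) (auto simp: R_def pos_le_divide_eq)
  qed
  then obtain t where t: "\<And>n. 1 \<le> t n" "\<And>n. t n \<le> R" "\<And>n. N (x n + t n *\<^sub>R z) = a"
    by metis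
  have "\<exists>s. 1 \<le> s \<and> s \<le> R \<and> N (x n - s *\<^sub>R z) = a" for n
  proof -
    have "N (x n + - z) \<le> a" "- z \<noteq> 0" using x(2)[of n] z by simp_all
    then obtain s where "1 \<le> s" "N (x n + s *\<^sub>R (- z)) = a" "s * N (- z) \<le> N (x n) + a"
      using is_norm_reach[OF N] by blast
    with x_le[of n] Nz show ?thesis
      by (intro exI[of _ s]) (auto simp: R_def pos_le_divide_eq is_norm_minus[OF N])
  qed
  then obtain s where s: "\<And>n. 1 \<le> s n" "\<And>n. s n \<le> R" "\<And>n. N (x n - s n *\<^sub>R z) = a"
    by metis
  define u v where "u n = (1/a) *\<^sub>R (x n + t n *\<^sub>R z)" and "v n = (1/a) *\<^sub>R (x n - s n *\<^sub>R z)" for n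
  have uv: "N (u n) = 1" "N (v n) = 1" for n
    using a s(3) t(3) by (simp_all add: u_def v_def is_norm_scaleR[OF N])
  have scale: "1 - (R/a) * i \<le> (1/a) * m" if "a - m \<le> R * i" for i m
  proof -
    have "(a - m) / a \<le> (R * i) / a"
      using that a by (intro divide_right_mono) auto
    then show ?thesis using a by (simp add: diff_divide_distrib)
  qed
  have "(\<lambda>n. N ((1/2) *\<^sub>R (u n + v n))) \<longlonglongrightarrow> 1"
  proof (rule tendsto_sandwich)
    show "\<forall>\<^sub>F n in sequentially. 1 - (R/a) * inverse (real (Suc n)) \<le> N ((1/2) *\<^sub>R (u n + v n))"
    proof (intro always_eventually allI)
      fix n
      let ?mid = "(1/2) *\<^sub>R ((x n + t n *\<^sub>R z) + (x n - s n *\<^sub>R z))"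
      have "a - N ?mid \<le> R * (a - N (x n))"
        using is_norm_chord_midpoint[OF N t(3) s(3) s(1,2) t(1,2) x_le] .
      also have "\<dots> \<le> R * inverse (real (Suc n))"
        using x(3)[of n] t(1,2)[of n] by (intro mult_left_mono) auto
      finally have "1 - (R/a) * inverse (real (Suc n)) \<le> (1/a) * N ?mid"
        by (rule scale)
      also have "\<dots> = N ((1/a) *\<^sub>R ?mid)"
        using a by (simp add: is_norm_scaleR[OF N])
      also have "(1/a) *\<^sub>R ?mid = (1/2) *\<^sub>R (u n + v n)"
        by (simp add: u_def v_def scaleR_add_right scaleR_diff_right mult.commute)
      finally show "1 - (R/a) * inverse (real (Suc n)) \<le> N ((1/2) *\<^sub>R (u n + v n))" .
    qed
    show "\<forall>\<^sub>F n in sequentially. N ((1/2) *\<^sub>R (u n + v n)) \<le> 1"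
    proof (intro always_eventually allI)
      fix n show "N ((1/2) *\<^sub>R (u n + v n)) \<le> 1"
        using is_norm_triangle[OF N, of "u n" "v n"] uv[of n] by (simp only: is_norm_scaleR[OF N])
    qed
    show "(\<lambda>n. 1 - (R/a) * inverse (real (Suc n))) \<longlonglongrightarrow> 1"
    proof -
      have "(\<lambda>n. 1 - (R/a) * inverse (real (Suc n))) \<longlonglongrightarrow> 1 - (R/a) * 0"
        by (intro tendsto_intros LIMSEQ_inverse_real_of_nat)
      then show ?thesis by simp
    qed
  qed simp
  moreover have diff: "u n - v n = ((t n + s n) / a) *\<^sub>R z" for n
  proof -
    have "u n - v n = (1/a) *\<^sub>R ((t n + s n) *\<^sub>R z)"
      unfolding u_def v_def scaleR_diff_right[symmetric] by (simp add: algebra_simps)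
    then show ?thesis by simp
  qed
  moreover have "\<exists>z r. \<forall>n. u n - v n = r n *\<^sub>R z"
    using diff by (intro exI[of _ z] exI[of _ "\<lambda>n. (t n + s n) / a"]) simp
  ultimately have "(\<lambda>n. N (u n - v n)) \<longlonglongrightarrow> 0"
    using spec[OF spec[OF \<open>URED N\<close>[unfolded URED_def], of u], of v] uv by simp
  moreover have "2 / a * N z \<le> N (u n - v n)" for n
    using s(1)[of n] t(1)[of n] a Nz
    unfolding diff is_norm_scaleR[OF N] by (intro mult_right_mono) (auto simp: divide_right_mono)
  ultimately have "2 / a * N z \<le> 0"
    by (intro LIMSEQ_le_const) auto
  then show False using a Nz by (simp add: mult_le_0_iff divide_le_0_iff)
qed

section \<open>The theorem of Hahn and Banach\<close>

definition sublinear :: "('a::real_vector \<Rightarrow> real) \<Rightarrow> bool" where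
  "sublinear p \<longleftrightarrow> (\<forall>x y. p (x + y) \<le> p x + p y) \<and> (\<forall>c x. 0 \<le> c \<longrightarrow> p (c *\<^sub>R x) = c * p x)"

lemma sublinear_add: "sublinear p \<Longrightarrow> p (x + y) \<le> p x + p y"
  and sublinear_scaleR: "sublinear p \<Longrightarrow> 0 \<le> c \<Longrightarrow> p (c *\<^sub>R x) = c * p x"
  by (auto simp: sublinear_def)

lemma sublinear_zero: "sublinear p \<Longrightarrow> p 0 = 0"
  using sublinear_scaleR[of p 0 0] by simp

lemma sublinear_minus_le: "sublinear p \<Longrightarrow> - p (- x) \<le> p x"
  using sublinear_add[of p x "- x"] sublinear_zero[of p] by simp

text \<open>One inequality suffices for homogeneity, as it can be applied to \<open>c\<close> and to \<open>1/c\<close>.\<close>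

lemma sublinearI:
  assumes add: "\<And>x y. p (x + y) \<le> p x + p y"
    and scale: "\<And>c x. 0 < c \<Longrightarrow> p (c *\<^sub>R x) \<le> c * p x"
    and zero: "p 0 = 0"
  shows "sublinear p"
proof -
  have "c * p x \<le> p (c *\<^sub>R x)" if "0 < c" for c x
    using scale[of "1/c" "c *\<^sub>R x"] that by (simp add: field_simps)
  then have "p (c *\<^sub>R x) = c * p x" if "0 \<le> c" for c x
    using that scale[of c x] zero by (cases "c = 0") (auto intro: antisym)
  then show ?thesis
    using add by (auto simp: sublinear_def)
qed

lemma sublinear_Inf:
  assumes "Q \<noteq> {}"
    and sub: "\<And>q. q \<in> Q \<Longrightarrow> sublinear q"
    and bdd: "\<And>x. bdd_below ((\<lambda>q. q x) ` Q)"
    and dir: "\<And>q r. q \<in> Q \<Longrightarrow> r \<in> Q \<Longrightarrow> \<exists>s\<in>Q. s \<le> q \<and> s \<le> r"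
  shows "sublinear (\<lambda>x. INF q\<in>Q. q x)"
proof (rule sublinearI)
  fix x y
  have lower: "(INF q\<in>Q. q z) \<le> q z" if "q \<in> Q" for q z
    using bdd that by (auto intro: cINF_lower)
  have "(INF q\<in>Q. q (x + y)) - r y \<le> q x" if q: "q \<in> Q" and r: "r \<in> Q" for q r
  proof -
    obtain s where s: "s \<in> Q" "s \<le> q" "s \<le> r"
      using dir[OF q r] by blast
    have "(INF q\<in>Q. q (x + y)) \<le> s (x + y)"
      by (rule lower[OF s(1)])
    also have "\<dots> \<le> s x + s y"
      by (rule sublinear_add[OF sub[OF s(1)]])
    also have "\<dots> \<le> q x + r y"
      using s by (auto simp: le_fun_def intro: add_mono)
    finally show ?thesis by simp
  qed
  then have "(INF q\<in>Q. q (x + y)) - r y \<le> (INF q\<in>Q. q x)" if "r \<in> Q" for r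
    using that \<open>Q \<noteq> {}\<close> by (intro cINF_greatest) auto
  then have "(INF q\<in>Q. q (x + y)) - (INF q\<in>Q. q x) \<le> r y" if "r \<in> Q" for r
    using that by (simp add: algebra_simps)
  then have "(INF q\<in>Q. q (x + y)) - (INF q\<in>Q. q x) \<le> (INF q\<in>Q. q y)"
    using \<open>Q \<noteq> {}\<close> by (intro cINF_greatest) auto
  then show "(INF q\<in>Q. q (x + y)) \<le> (INF q\<in>Q. q x) + (INF q\<in>Q. q y)"
    by simp
next
  fix c :: real and x
  assume "0 < c"
  have "(INF q\<in>Q. q (c *\<^sub>R x)) / c \<le> q x" if "q \<in> Q" for q
  proof -
    have "(INF q\<in>Q. q (c *\<^sub>R x)) \<le> q (c *\<^sub>R x)"
      using bdd that by (auto intro: cINF_lower)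
    then show ?thesis
      using \<open>0 < c\<close> sub[OF that] by (simp add: sublinear_scaleR divide_le_eq mult.commute)
  qed
  then have "(INF q\<in>Q. q (c *\<^sub>R x)) / c \<le> (INF q\<in>Q. q x)"
    using \<open>Q \<noteq> {}\<close> by (intro cINF_greatest)
  then show "(INF q\<in>Q. q (c *\<^sub>R x)) \<le> c * (INF q\<in>Q. q x)"
    using \<open>0 < c\<close> by (simp add: divide_le_eq mult.commute)
next
  have "(INF q\<in>Q. q 0) = (INF q\<in>Q. (0::real))"
    using sub by (intro INF_cong refl) (simp add: sublinear_zero)
  then show "(INF q\<in>Q. q 0) = 0"
    using \<open>Q \<noteq> {}\<close> by simp
qed

text \<open>The infimum over \<open>t \<ge> 0\<close> of \<open>p (y + t x) - t p x\<close> is the largest sublinear functional below \<open>p\<close>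
  that agrees with \<open>p\<close> at \<open>x\<close> and is additive along the ray through \<open>x\<close>. Additivity
  determines its value at \<open>- x\<close>. A minimal sublinear functional is therefore odd, and
  an odd sublinear functional is linear; this is the whole proof of the theorem of Hahn and Banach
  below.\<close>

lemma sublinear_tighten:
  assumes p: "sublinear p"
  obtains q where "sublinear q" "q \<le> p" "q (- x) \<le> - p x"
proof
  define q where "q = (\<lambda>y. INF t\<in>{0..}. p (y + t *\<^sub>R x) - t * p x)"
  have lb: "- p (- y) \<le> p (y + t *\<^sub>R x) - t * p x" if "0 \<le> t" for y t
    using sublinear_add[OF p, of "y + t *\<^sub>R x" "- y"] sublinear_scaleR[OF p that, of x] by simp
  then have bdd: "bdd_below ((\<lambda>t. p (y + t *\<^sub>R x) - t * p x) ` {0..})" for y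
    by (intro bdd_belowI[of _ "- p (- y)"]) auto
  have q_le: "q y \<le> p (y + t *\<^sub>R x) - t * p x" if "0 \<le> t" for y t
    unfolding q_def using that by (intro cINF_lower[OF bdd]) auto
  have q_greatest: "b \<le> q y" if "\<And>t. 0 \<le> t \<Longrightarrow> b \<le> p (y + t *\<^sub>R x) - t * p x" for b y
    unfolding q_def using that by (intro cINF_greatest) auto
  show "q \<le> p"
    using q_le[of 0] by (auto simp: le_fun_def)
  show "q (- x) \<le> - p x"
    using q_le[of 1 "- x"] sublinear_zero[OF p] by simp
  show "sublinear q"
  proof (rule sublinearI)
    fix y z
    have "q (y + z) - (p (z + t *\<^sub>R x) - t * p x) \<le> p (y + s *\<^sub>R x) - s * p x"
      if "0 \<le> s" "0 \<le> t" for s t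
    proof -
      have "q (y + z) \<le> p ((y + z) + (s + t) *\<^sub>R x) - (s + t) * p x"
        using that by (intro q_le) auto
      also have "(y + z) + (s + t) *\<^sub>R x = (y + s *\<^sub>R x) + (z + t *\<^sub>R x)"
        by (simp add: algebra_simps)
      also have "p \<dots> \<le> p (y + s *\<^sub>R x) + p (z + t *\<^sub>R x)"
        by (rule sublinear_add[OF p])
      finally show ?thesis by (simp add: algebra_simps)
    qed
    then have "q (y + z) - (p (z + t *\<^sub>R x) - t * p x) \<le> q y" if "0 \<le> t" for t
      using that by (intro q_greatest) auto
    then have "q (y + z) - q y \<le> q z"
      by (intro q_greatest) (simp add: algebra_simps)
    then show "q (y + z) \<le> q y + q z" by simp
  next
    fix c :: real and y
    assume "0 < c"
    have "q (c *\<^sub>R y) / c \<le> q y"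
    proof (rule q_greatest)
      fix t :: real assume "0 \<le> t"
      have "q (c *\<^sub>R y) \<le> p (c *\<^sub>R y + (c * t) *\<^sub>R x) - (c * t) * p x"
        using \<open>0 < c\<close> \<open>0 \<le> t\<close> by (intro q_le) auto
      also have "c *\<^sub>R y + (c * t) *\<^sub>R x = c *\<^sub>R (y + t *\<^sub>R x)"
        by (simp add: scaleR_add_right)
      also have "p \<dots> = c * p (y + t *\<^sub>R x)"
        using \<open>0 < c\<close> by (intro sublinear_scaleR[OF p]) auto
      finally have "q (c *\<^sub>R y) \<le> (p (y + t *\<^sub>R x) - t * p x) * c"
        by (simp add: algebra_simps)
      then show "q (c *\<^sub>R y) / c \<le> p (y + t *\<^sub>R x) - t * p x"
        using \<open>0 < c\<close> by (simp add: pos_divide_le_eq)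
    qed
    then show "q (c *\<^sub>R y) \<le> c * q y"
      using \<open>0 < c\<close> by (simp add: divide_le_eq mult.commute)
  next
    show "q 0 = 0"
    proof (rule antisym)
      show "q 0 \<le> 0" using q_le[of 0 0] sublinear_zero[OF p] by simp
      show "0 \<le> q 0"
        using lb[of _ 0] sublinear_zero[OF p] by (intro q_greatest) simp
    qed
  qed
qed

text \<open>A linear functional is the same as a minimal sublinear one, and Zorn's lemma yields these below
  any sublinear functional. To get the value \<open>p x0\<close> at \<open>x0\<close>, the search starts from a functional
  that already satisfies \<open>p0 (- x0) \<le> - p x0\<close>.\<close>

theorem hahn_banach_sublinear:
  fixes p :: "'a::real_vector \<Rightarrow> real"
  assumes p: "sublinear p"
  obtains L where "linear L" "L \<le> p" "L x0 = p x0"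
proof -
  obtain p0 where p0: "sublinear p0" "p0 \<le> p" "p0 (- x0) \<le> - p x0"
    using sublinear_tighten[OF p] by blast
  define S where "S = {q. sublinear q \<and> q \<le> p0}"
  define P where "P = (\<lambda>q r :: 'a \<Rightarrow> real. r \<le> q)"
  have "\<exists>m\<in>S. \<forall>a\<in>S. P m a \<longrightarrow> a = m"
  proof (rule predicate_Zorn)
    show "partial_order_on S (relation_of P S)"
      by (rule partial_order_on_relation_ofI) (auto simp: P_def)
  next
    fix C assume C: "C \<in> Chains (relation_of P S)"
    have CS: "q \<in> S" if "q \<in> C" for q
      using C that by (auto simp: Chains_def relation_of_def)
    have chain: "q \<le> r \<or> r \<le> q" if "q \<in> C" "r \<in> C" for q r
      using C that by (auto simp: Chains_def relation_of_def P_def)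
    show "\<exists>u\<in>S. \<forall>a\<in>C. P a u"
    proof (cases "C = {}")
      case True
      then show ?thesis using p0 by (auto simp: S_def)
    next
      case False
      have bdd: "bdd_below ((\<lambda>q. q x) ` C)" for x
      proof (rule bdd_belowI)
        fix v assume "v \<in> (\<lambda>q. q x) ` C"
        then obtain q where q: "q \<in> C" "v = q x" by blast
        have "- p0 (- x) \<le> - q (- x)"
          using CS[OF q(1)] by (auto simp: S_def le_fun_def)
        also have "\<dots> \<le> q x"
          using CS[OF q(1)] by (auto simp: S_def intro: sublinear_minus_le)
        finally show "- p0 (- x) \<le> v" using q by simp
      qed
      define u where "u = (\<lambda>x. INF q\<in>C. q x)"
      have u_le: "u \<le> q" if "q \<in> C" for q
        using that bdd by (auto simp: u_def le_fun_def intro: cINF_lower)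
      have "sublinear u"
        unfolding u_def
      proof (rule sublinear_Inf[OF False _ bdd])
        show "sublinear q" if "q \<in> C" for q using CS[OF that] by (simp add: S_def)
        show "\<exists>s\<in>C. s \<le> q \<and> s \<le> r" if "q \<in> C" "r \<in> C" for q r
          using chain[OF that] that by blast
      qed
      moreover obtain q where "q \<in> C" using False by blast
      then have "u \<le> p0"
        using u_le[of q] CS[of q] by (auto simp: S_def)
      ultimately show ?thesis
        using u_le by (auto simp: S_def P_def)
    qed
  qed
  then obtain L where L: "sublinear L" "L \<le> p0"
    and min: "\<And>q. sublinear q \<Longrightarrow> q \<le> L \<Longrightarrow> q = L"
    unfolding S_def P_def by (blast intro: order_trans)
  have minus: "L (- x) = - L x" for x
  proof (rule antisym)
    obtain q where "sublinear q" "q \<le> L" "q (- x) \<le> - L x"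
      using sublinear_tighten[OF L(1)] by blast
    then show "L (- x) \<le> - L x" using min by metis
    show "- L x \<le> L (- x)"
      using sublinear_minus_le[OF L(1), of "- x"] by simp
  qed
  have "linear L"
  proof (rule linearI)
    fix x y
    have "- L (x + y) \<le> - L x - L y"
      using sublinear_add[OF L(1), of "- x" "- y"] minus[of "x + y"] minus[of x] minus[of y]
      by simp
    then show "L (x + y) = L x + L y"
      using sublinear_add[OF L(1), of x y] by simp
  next
    fix c x
    show "L (c *\<^sub>R x) = c *\<^sub>R L x"
    proof (cases "0 \<le> c")
      case False
      have "L (c *\<^sub>R x) = - L ((- c) *\<^sub>R x)"
        using minus[of "c *\<^sub>R x"] by simp
      then show ?thesis
        using False sublinear_scaleR[OF L(1), of "- c" x] by simp
    qed (simp add: sublinear_scaleR[OF L(1)])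
  qed
  moreover have "L \<le> p" using L p0 by (meson order_trans)
  moreover have "L x0 = p x0"
  proof (rule antisym)
    show "L x0 \<le> p x0" using \<open>L \<le> p\<close> by (simp add: le_fun_def)
    have "L (- x0) \<le> p0 (- x0)" using L(2) by (simp add: le_fun_def)
    then show "p x0 \<le> L x0" using p0(3) minus[of x0] by simp
  qed
  ultimately show thesis by (rule that)
qed

section \<open>A strictly positive functional from a URED norm\<close>

definition bc_mult :: "('k::topological_space \<Rightarrow>\<^sub>C real) \<Rightarrow> ('k \<Rightarrow>\<^sub>C real) \<Rightarrow> ('k \<Rightarrow>\<^sub>C real)" where
  "bc_mult f g = Bcontfun (\<lambda>t. f t * g t)"

lemma norm_bcontfun_le_iff: "norm (f :: 'k::topological_space \<Rightarrow>\<^sub>C real) \<le> b \<longleftrightarrow> (\<forall>t. \<bar>f t\<bar> \<le> b)"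
  using norm_bounded[of f] norm_bound[of f b] by (metis order_trans real_norm_def)

lemma bc_mult_apply [simp]: "bc_mult f g t = f t * g t"
proof -
  have "\<bar>f t\<bar> * \<bar>g t\<bar> \<le> norm f * norm g" for t
    using norm_bounded[of f t] norm_bounded[of g t] by (intro mult_mono) auto
  then have "(\<lambda>t. f t * g t) \<in> bcontfun"
    by (intro bcontfun_normI[where b = "norm f * norm g"] continuous_intros) (auto simp: abs_mult)
  then show ?thesis
    by (simp add: bc_mult_def Bcontfun_inverse)
qed

text \<open>Suppose that some \<open>x\<close> attains the maximum \<open>a\<close> of \<open>N\<close> on the unit ball of the sup norm, and let
  \<open>\<phi>\<close> be a functional with \<open>\<phi> \<le> N\<close> and \<open>\<phi> x = a\<close>. Then \<open>L g = \<phi> (x g)\<close> is what is wanted. If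
  \<open>0 \<le> g \<le> 1\<close>, the function \<open>x (1 - g)\<close> stays in the unit ball when \<open>g\<close> is added or subtracted. So
  \<open>N (x (1 - g)) \<le> a - d\<close>, where \<open>d\<close> is the drop in the direction \<open>g\<close>, and
  \<open>L g = \<phi> x - \<phi> (x (1 - g)) \<ge> d\<close>; the same computation with \<open>d = 0\<close> gives positivity.

  In general the maximum is only approached, by a sequence \<open>x n\<close>. As \<open>d\<close> does not depend on the
  centre, one can replace \<open>N (x g)\<close> by \<open>p g\<close>, the upper limit of \<open>N (x n g)\<close>, and take for \<open>L\<close> a
  linear functional below \<open>p\<close> with \<open>L 1 = p 1\<close>.\<close>

lemma URED_imp_strictly_positive_functional:
  fixes N :: "('k::topological_space \<Rightarrow>\<^sub>C real) \<Rightarrow> real"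
  assumes "equivalent_norm N" and "URED N"
  obtains L :: "('k \<Rightarrow>\<^sub>C real) \<Rightarrow> real" where "linear L"
    "\<forall>g. (\<forall>t. 0 \<le> apply_bcontfun g t) \<longrightarrow> 0 \<le> L g"
    "\<forall>g. (\<forall>t. 0 \<le> apply_bcontfun g t) \<longrightarrow> g \<noteq> 0 \<longrightarrow> 0 < L g"
proof -
  obtain c C where N: "is_norm N" and cC: "0 < c" "0 < C"
    and le_N: "\<And>x. c * norm x \<le> N x" and N_le: "\<And>x. N x \<le> C * norm x"
    using assms by (auto simp: equivalent_norm_def)
  define one :: "'k \<Rightarrow>\<^sub>C real" where "one = const_bcontfun 1"
  have one [simp]: "one t = 1" for t by (simp add: one_def)
  define a where "a = (SUP x\<in>{x. norm x \<le> 1}. N x)"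
  have ball: "N x \<le> C" if "norm x \<le> 1" for x
    using order_trans[OF N_le mult_left_mono[OF that, of C]] cC by simp
  then have bdd: "bdd_above (N ` {x. norm x \<le> 1})"
    by (auto simp: bdd_above_def)
  have N_le_a: "N x \<le> a" if "norm x \<le> 1" for x
    unfolding a_def using that by (intro cSUP_upper[OF _ bdd]) auto
  have "norm one = 1"
    using norm_bounded[of one undefined] by (intro antisym) (auto simp: norm_bcontfun_le_iff)
  with N_le_a[of one] le_N[of one] cC have a: "0 < a" by simp
  have "\<exists>x. norm x \<le> 1 \<and> a - inverse (real (Suc n)) < N x" for n
  proof -
    have "a - inverse (real (Suc n)) < a" by simp
    then have "\<exists>x\<in>{x. norm x \<le> 1}. a - inverse (real (Suc n)) < N x"
      unfolding a_def using norm_zero by (subst less_cSUP_iff[OF _ bdd, symmetric]) (auto intro: exI[of _ 0])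
    then show ?thesis by auto
  qed
  then obtain x where x: "\<And>n. norm (x n) \<le> 1" "\<And>n. a - inverse (real (Suc n)) < N (x n)"
    by metis
  \<comment> \<open>the upper limit of \<open>N (x n g)\<close>\<close>
  define p where "p g = Inf {b. \<forall>\<^sub>F n in sequentially. N (bc_mult (x n) g) \<le> b}" for g
  have bddp: "bdd_below {b. \<forall>\<^sub>F n in sequentially. N (bc_mult (x n) g) \<le> b}" for g
  proof (rule bdd_belowI)
    fix b assume "b \<in> {b. \<forall>\<^sub>F n in sequentially. N (bc_mult (x n) g) \<le> b}"
    then obtain n where "N (bc_mult (x n) g) \<le> b"
      by (auto simp: eventually_sequentially)
    then show "0 \<le> b" using is_norm_nonneg[OF N] order_trans by blast
  qed
  have p_le: "p g \<le> b" if "\<forall>\<^sub>F n in sequentially. N (bc_mult (x n) g) \<le> b" for g b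
    unfolding p_def using that by (intro cInf_lower[OF _ bddp]) auto
  have norm_le: "norm (bc_mult (x n) g) \<le> norm g" for n g
    unfolding norm_bcontfun_le_iff
  proof
    fix t
    have "\<bar>x n t\<bar> * \<bar>g t\<bar> \<le> 1 * norm g"
      using x(1)[of n] norm_bounded[of g t] by (intro mult_mono) (auto simp: norm_bcontfun_le_iff)
    then show "\<bar>bc_mult (x n) g t\<bar> \<le> norm g" by (simp add: abs_mult)
  qed
  have nonempty: "{b. \<forall>\<^sub>F n in sequentially. N (bc_mult (x n) g) \<le> b} \<noteq> {}" for g
  proof -
    have "N (bc_mult (x n) g) \<le> C * norm g" for n
      using N_le[of "bc_mult (x n) g"] norm_le[of n g] cC
      by (meson less_imp_le mult_left_mono order_trans)
    then have "\<forall>\<^sub>F n in sequentially. N (bc_mult (x n) g) \<le> C * norm g"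
      by simp
    then show ?thesis by blast
  qed
  have p_lessD: "\<forall>\<^sub>F n in sequentially. N (bc_mult (x n) g) \<le> b" if "p g < b" for g b
  proof -
    obtain b' where b': "\<forall>\<^sub>F n in sequentially. N (bc_mult (x n) g) \<le> b'" "b' < b"
      using cInf_lessD[OF nonempty \<open>p g < b\<close>[unfolded p_def]] by auto
    show ?thesis
      using b'(1) by (rule eventually_mono) (use b'(2) in simp)
  qed
  have "sublinear p"
  proof (rule sublinearI)
    fix f g
    show "p (f + g) \<le> p f + p g"
    proof (rule field_le_epsilon)
      fix e :: real assume "0 < e"
      then have "\<forall>\<^sub>F n in sequentially. N (bc_mult (x n) f) \<le> p f + e/2"
        "\<forall>\<^sub>F n in sequentially. N (bc_mult (x n) g) \<le> p g + e/2"
        by (auto intro: p_lessD)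
      then have "\<forall>\<^sub>F n in sequentially. N (bc_mult (x n) (f + g)) \<le> p f + p g + e"
      proof eventually_elim
        case (elim n)
        have "bc_mult (x n) (f + g) = bc_mult (x n) f + bc_mult (x n) g"
          by (rule bcontfun_eqI) (simp add: algebra_simps)
        with elim is_norm_triangle[OF N, of "bc_mult (x n) f" "bc_mult (x n) g"] show ?case
          by simp
      qed
      then show "p (f + g) \<le> p f + p g + e" by (rule p_le)
    qed
  next
    fix r :: real and g assume "0 < r"
    show "p (r *\<^sub>R g) \<le> r * p g"
    proof (rule field_le_epsilon)
      fix e :: real assume "0 < e"
      then have "\<forall>\<^sub>F n in sequentially. N (bc_mult (x n) g) \<le> p g + e/r"
        using \<open>0 < r\<close> by (intro p_lessD) simp
      then have "\<forall>\<^sub>F n in sequentially. N (bc_mult (x n) (r *\<^sub>R g)) \<le> r * p g + e"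
      proof eventually_elim
        case (elim n)
        have "bc_mult (x n) (r *\<^sub>R g) = r *\<^sub>R bc_mult (x n) g"
          by (rule bcontfun_eqI) simp
        moreover have "r * N (bc_mult (x n) g) \<le> r * (p g + e/r)"
          using elim \<open>0 < r\<close> by (intro mult_left_mono) auto
        ultimately show ?case
          using \<open>0 < r\<close> by (simp add: is_norm_scaleR[OF N] distrib_left)
      qed
      then show "p (r *\<^sub>R g) \<le> r * p g + e" by (rule p_le)
    qed
  next
    have "bc_mult (x n) 0 = 0" for n
      by (rule bcontfun_eqI) simp
    then have "N (bc_mult (x n) 0) = 0" for n
      using is_norm_eq_zero[OF N, of 0] by simp
    then show "p 0 = 0"
      unfolding p_def by (simp flip: atLeast_def)
  qed
  then obtain L where L: "linear L" "L \<le> p" "L one = p one"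
    using hahn_banach_sublinear by blast
  have mult_one: "bc_mult (x n) one = x n" for n
    by (rule bcontfun_eqI) simp
  have "a \<le> p one"
  proof (rule field_le_epsilon)
    fix e :: real assume "0 < e"
    have "\<forall>\<^sub>F n in sequentially. inverse (real (Suc n)) < e/2"
      by (rule order_tendstoD(2)[OF LIMSEQ_inverse_real_of_nat]) (simp add: \<open>0 < e\<close>)
    moreover have "\<forall>\<^sub>F n in sequentially. N (x n) \<le> p one + e/2"
      using p_lessD[of one "p one + e/2"] \<open>0 < e\<close> by (simp add: mult_one)
    ultimately have "\<forall>\<^sub>F n in sequentially. a \<le> p one + e"
    proof eventually_elim
      case (elim n) then show ?case using x(2)[of n] by simp
    qed
    then show "a \<le> p one + e" by simp
  qed
  then have L_ge: "a - p (one - g) \<le> L g" for g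
  proof -
    have "L one - L g \<le> p (one - g)"
      using le_funD[OF L(2), of "one - g"] by (simp only: linear_diff[OF L(1)])
    with \<open>a \<le> p one\<close> L(3) show ?thesis by simp
  qed
  have pos1: "0 \<le> L g" if "\<And>t. 0 \<le> apply_bcontfun g t" "\<And>t. apply_bcontfun g t \<le> 1" for g :: "'k \<Rightarrow>\<^sub>C real"
  proof -
    have "norm (one - g) \<le> 1"
      using that by (simp add: norm_bcontfun_le_iff abs_le_iff add_increasing)
    then have "p (one - g) \<le> a"
      by (intro p_le always_eventually allI N_le_a order_trans[OF norm_le])
    then show ?thesis using L_ge[of g] by simp
  qed
  have strict1: "0 < L g" if g: "\<And>t. 0 \<le> apply_bcontfun g t" "\<And>t. apply_bcontfun g t \<le> 1" "g \<noteq> 0" for g :: "'k \<Rightarrow>\<^sub>C real"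
  proof -
    obtain d where d: "0 < d" "\<And>x. N (x + g) \<le> a \<Longrightarrow> N (x - g) \<le> a \<Longrightarrow> N x \<le> a - d"
      using URED_midpoint_drop[OF N \<open>URED N\<close> \<open>g \<noteq> 0\<close> a] by blast
    have "N (bc_mult (x n) (one - g)) \<le> a - d" for n
    proof (intro d(2) N_le_a)
      \<comment> \<open>at each point a convex combination of \<open>x n t\<close> and one of \<open>1\<close>, \<open>-1\<close>, with weight \<open>g t\<close>\<close>
      have bound: "\<bar>x n t * (1 - g t) + g t\<bar> \<le> 1" "\<bar>x n t * (1 - g t) - g t\<bar> \<le> 1" for t
      proof -
        have "\<bar>x n t * (1 - g t)\<bar> \<le> 1 * (1 - g t)"
          using x(1)[of n] g(2)[of t] unfolding abs_mult
          by (intro mult_mono) (auto simp: norm_bcontfun_le_iff)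
        then show "\<bar>x n t * (1 - g t) + g t\<bar> \<le> 1" "\<bar>x n t * (1 - g t) - g t\<bar> \<le> 1"
          using g(1)[of t] by (simp_all add: abs_le_iff)
      qed
      then show "norm (bc_mult (x n) (one - g) + g) \<le> 1" "norm (bc_mult (x n) (one - g) - g) \<le> 1"
        by (simp_all add: norm_bcontfun_le_iff)
    qed
    then have "p (one - g) \<le> a - d"
      by (intro p_le always_eventually allI)
    with L_ge[of g] d(1) show ?thesis by simp
  qed
  have scaled: "\<exists>r>0. (\<forall>t. 0 \<le> (r *\<^sub>R g) t) \<and> (\<forall>t. (r *\<^sub>R g) t \<le> 1) \<and> L g = L (r *\<^sub>R g) / r"
    if "\<And>t. 0 \<le> apply_bcontfun g t" for g :: "'k \<Rightarrow>\<^sub>C real"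
  proof (intro exI conjI allI)
    let ?r = "1 / (1 + norm g)"
    show r: "?r > 0" by (simp add: add_pos_nonneg)
    then show "L g = L (?r *\<^sub>R g) / ?r" by (simp add: linear_scale[OF L(1)])
    fix t
    show "0 \<le> (?r *\<^sub>R g) t" using r that[of t] by simp
    have "g t \<le> 1 + norm g" using norm_bounded[of g t] by simp
    then show "(?r *\<^sub>R g) t \<le> 1" using r by (simp add: divide_le_eq split: if_splits)
  qed
  have "0 \<le> L g \<and> (g \<noteq> 0 \<longrightarrow> 0 < L g)" if "\<forall>t. 0 \<le> apply_bcontfun g t" for g
  proof -
    obtain r where "r > 0" "\<forall>t. 0 \<le> (r *\<^sub>R g) t" "\<forall>t. (r *\<^sub>R g) t \<le> 1" "L g = L (r *\<^sub>R g) / r"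
      using scaled \<open>\<forall>t. 0 \<le> apply_bcontfun g t\<close> by blast
    then show ?thesis
      using pos1[of "r *\<^sub>R g"] strict1[of "r *\<^sub>R g"] by auto
  qed
  then show thesis
    by (intro that[OF L(1)]) auto
qed

section \<open>A measure from a positive functional\<close>

lemma Bcontfun_compact:
  assumes "compact (UNIV :: 'k::topological_space set)" and "continuous_on UNIV (h :: 'k \<Rightarrow> real)"
  shows "apply_bcontfun (Bcontfun h) = h"
proof (rule Bcontfun_inverse)
  show "h \<in> bcontfun"
    unfolding bcontfun_compact[OF assms(1)] using assms(2) by simp
qed

definition subordinate :: "'k set \<Rightarrow> ('k::topological_space \<Rightarrow>\<^sub>C real) set" where
  "subordinate U = {f. \<forall>t. 0 \<le> apply_bcontfun f t \<and> f t \<le> 1 \<and> (t \<notin> U \<longrightarrow> f t = 0)}"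

lemma subordinateD:
  assumes "f \<in> subordinate U"
  shows "0 \<le> apply_bcontfun f t" "f t \<le> 1" "t \<notin> U \<Longrightarrow> f t = 0"
  using assms by (auto simp: subordinate_def)

text \<open>Cutting off at height \<open>e\<close> replaces a function that merely vanishes off an open set by one that
  vanishes off a compact subset of it, at a cost of at most \<open>e\<close>.\<close>

definition shrink :: "real \<Rightarrow> ('k::topological_space \<Rightarrow>\<^sub>C real) \<Rightarrow> 'k \<Rightarrow>\<^sub>C real" where
  "shrink e f = Bcontfun (\<lambda>t. max 0 (f t - e))"

definition open_content :: "(('k::topological_space \<Rightarrow>\<^sub>C real) \<Rightarrow> real) \<Rightarrow> 'k set \<Rightarrow> ennreal" where
  "open_content L U = (SUP f\<in>subordinate U. ennreal (L f))"

text \<open>The outer measure from the construction of Riesz and Markov.\<close>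

definition functional_outer :: "(('k::topological_space \<Rightarrow>\<^sub>C real) \<Rightarrow> real) \<Rightarrow> 'k set \<Rightarrow> ennreal" where
  "functional_outer L A = (INF U\<in>{U. open U \<and> A \<subseteq> U}. open_content L U)"

lemma compact_t2_bump:
  assumes "compact (UNIV :: 'k::t2_space set)" and "open (U :: 'k set)" and "s \<in> U"
  obtains g where "g \<in> subordinate U" "g s = 1"
proof -
  have "normal_space (euclidean :: 'k topology)"
    using assms(1) by (intro compact_Hausdorff_or_regular_imp_normal_space)
      (auto simp: compact_space_def Hausdorff_space_def separation_t2 disjnt_def)
  then obtain f where f: "continuous_map euclidean (top_of_set {0..1::real}) f"
      "f ` (- U) \<subseteq> {0}" "f ` {s} \<subseteq> {1}"
    using assms by (auto elim!: Urysohn_lemma[of euclidean "- U" "{s}" 0 1])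
  then have cont: "continuous_on UNIV f" and range: "f t \<in> {0..1}" for t
    by (auto simp: continuous_map_in_subtopology)
  have [simp]: "apply_bcontfun (Bcontfun f) = f"
    by (rule Bcontfun_compact[OF assms(1) cont])
  show thesis
    using f(2,3) range by (intro that[of "Bcontfun f"]) (auto simp: subordinate_def)
qed

context
  fixes L :: "('k::t2_space \<Rightarrow>\<^sub>C real) \<Rightarrow> real"
  assumes K: "compact (UNIV :: 'k set)"
    and lin: "linear L"
    and L_nonneg: "\<forall>g. (\<forall>t. 0 \<le> apply_bcontfun g t) \<longrightarrow> 0 \<le> L g"
begin

lemma functional_nonneg: "(\<And>t. 0 \<le> apply_bcontfun g t) \<Longrightarrow> 0 \<le> L g"
  using L_nonneg by blast

lemma functional_mono:
  assumes "\<And>t. apply_bcontfun f t \<le> apply_bcontfun g t" shows "L f \<le> L g"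
  using functional_nonneg[of "g - f"] assms by (simp add: linear_diff[OF lin])

lemma shrink_apply [simp]: "shrink e f t = max 0 (f t - e)" for f :: "'k \<Rightarrow>\<^sub>C real"
  unfolding shrink_def by (subst Bcontfun_compact[OF K]) (auto intro!: continuous_intros)

lemma functional_le_shrink: "L f \<le> L (shrink e f) + e * L (const_bcontfun 1)"
proof -
  have "L f \<le> L (shrink e f + e *\<^sub>R const_bcontfun 1)"
    by (intro functional_mono) simp
  then show ?thesis
    by (simp add: linear_add[OF lin] linear_scale[OF lin])
qed

text \<open>Estimates of \<open>L f\<close> need be proved only for the cut-off functions. The summand \<open>w\<close> makes
  this applicable to superadditivity without a subtraction of extended reals.\<close>

lemma functional_le_if_shrink_le:
  assumes "\<And>e. 0 < e \<Longrightarrow> ennreal (L (shrink e f)) + w \<le> B"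
  shows "ennreal (L f) + w \<le> B"
proof (rule ennreal_le_epsilon)
  fix r :: real assume "0 < r"
  define c where "c = L (const_bcontfun 1)"
  have c: "0 \<le> c" unfolding c_def by (intro functional_nonneg) simp
  define e where "e = r / (c + 1)"
  have e: "0 < e" "e * c \<le> r"
    using c \<open>0 < r\<close> by (auto simp: e_def field_simps)
  have nonneg: "0 \<le> L (shrink e f)" by (intro functional_nonneg) simp
  have "ennreal (L f) \<le> ennreal (L (shrink e f) + r)"
    using functional_le_shrink[of f e] e by (intro ennreal_leI) (simp add: c_def)
  also have "\<dots> = ennreal (L (shrink e f)) + ennreal r"
    using nonneg \<open>0 < r\<close> by (intro ennreal_plus) auto
  finally have "ennreal (L f) + w \<le> ennreal (L (shrink e f)) + ennreal r + w"
    by (rule add_right_mono)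
  also have "\<dots> = ennreal (L (shrink e f)) + w + ennreal r"
    by (simp add: ac_simps)
  also have "\<dots> \<le> B + ennreal r"
    by (intro add_right_mono assms e(1))
  finally show "ennreal (L f) + w \<le> B + ennreal r" .
qed

lemma functional_le_open_content: "f \<in> subordinate U \<Longrightarrow> ennreal (L f) \<le> open_content L U"
  unfolding open_content_def by (rule SUP_upper)

lemma open_content_mono: "U \<subseteq> V \<Longrightarrow> open_content L U \<le> open_content L V"
  unfolding open_content_def by (intro SUP_subset_mono) (auto simp: subordinate_def)

lemma zero_subordinate: "0 \<in> subordinate U"
  by (simp add: subordinate_def)

lemma open_content_empty: "open_content L {} = 0"
proof -
  have "f = 0" if "f \<in> subordinate {}" for f :: "'k \<Rightarrow>\<^sub>C real"
    using subordinateD(3)[OF that] by (intro bcontfun_eqI) simp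
  then have "subordinate {} = {0 :: 'k \<Rightarrow>\<^sub>C real}"
    using zero_subordinate by blast
  then show ?thesis
    by (simp add: open_content_def linear_0[OF lin])
qed

lemma open_content_UNIV: "open_content L UNIV = ennreal (L (const_bcontfun 1))"
  unfolding open_content_def
proof (rule antisym)
  show "(SUP f\<in>subordinate UNIV. ennreal (L f)) \<le> ennreal (L (const_bcontfun 1))"
    by (intro SUP_least ennreal_leI functional_mono) (auto dest: subordinateD)
  show "ennreal (L (const_bcontfun 1)) \<le> (SUP f\<in>subordinate UNIV. ennreal (L f))"
    by (intro SUP_upper) (auto simp: subordinate_def)
qed

lemma bc_sum_apply: "(\<Sum>i\<in>I. h i) t = (\<Sum>i\<in>I. h i t)" for h :: "'i \<Rightarrow> 'k \<Rightarrow>\<^sub>C real"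
  by (induction I rule: infinite_finite_induct) auto

text \<open>A partition of unity: the set where \<open>f \<ge> e\<close> is compact, so finitely many bumps subordinate to the
  \<open>U i\<close> cover it, and dividing by their sum \<open>S\<close> splits the cut-off function into pieces. The pieces
  that belong to the same \<open>U j\<close> are added up to a function subordinate to \<open>U j\<close>.\<close>

lemma open_content_UN_le:
  assumes U: "\<And>i::nat. open (U i)"
  shows "open_content L (\<Union>i. U i) \<le> (\<Sum>i. open_content L (U i))"
  unfolding open_content_def[of L "\<Union>i. U i"]
proof (rule SUP_least)
  fix f
  assume f: "f \<in> subordinate (\<Union>i. U i)"
  have "ennreal (L (shrink e f)) \<le> (\<Sum>j. open_content L (U j))" if e: "0 < e" for e
  proof -
    define C where "C = {t. e \<le> f t}"
    have "closed C"
      unfolding C_def by (intro closed_Collect_le continuous_intros) auto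
    then have "compact C"
      using K compact_Int_closed[OF K] by simp
    have C_sub: "C \<subseteq> (\<Union>i. U i)"
      using subordinateD(3)[OF f] e by (force simp: C_def)
    have "\<exists>i g. s \<in> U i \<and> g \<in> subordinate (U i) \<and> g s = 1" if "s \<in> C" for s
    proof -
      obtain i where i: "s \<in> U i" using \<open>s \<in> C\<close> C_sub by blast
      obtain g where g: "g \<in> subordinate (U i)" "g s = 1"
        by (rule compact_t2_bump[OF K U i])
      show ?thesis by (intro exI conjI) (rule i g)+
    qed
    then obtain i g where ig: "\<And>s. s \<in> C \<Longrightarrow> g s \<in> subordinate (U (i s))" "\<And>s. s \<in> C \<Longrightarrow> g s s = 1"
      by metis
    have "\<exists>D\<subseteq>C. finite D \<and> C \<subseteq> (\<Union>s\<in>D. {t. 1/2 < g s t})"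
    proof (rule compactE_image[OF \<open>compact C\<close>])
      show "open {t. 1/2 < g s t}" for s
        by (intro open_Collect_less continuous_intros) auto
      show "C \<subseteq> (\<Union>s\<in>C. {t. 1/2 < g s t})"
        using ig(2) by force
    qed blast
    then obtain D where D: "D \<subseteq> C" "finite D" and cover: "C \<subseteq> (\<Union>s\<in>D. {t. 1/2 < g s t})"
      by blast
    define S where "S t = (\<Sum>s\<in>D. g s t)" for t
    have g_nonneg: "0 \<le> g s t" if "s \<in> D" for s t
      using that D ig(1) subordinateD(1) by blast
    have S_big: "1/2 < S t" if "t \<in> C" for t
    proof -
      obtain s where s: "s \<in> D" "1/2 < g s t" using cover \<open>t \<in> C\<close> by blast
      then have "g s t \<le> S t"
        unfolding S_def using D g_nonneg by (intro member_le_sum) auto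
      with s show ?thesis by simp
    qed
    \<comment> \<open>the maximum avoids a division by zero where \<open>S\<close> is small, and the cut-off function vanishes there\<close>
    define h where "h s = Bcontfun (\<lambda>t. max 0 (f t - e) * g s t / max (1/2) (S t))" for s
    have h: "h s t = max 0 (f t - e) * g s t / max (1/2) (S t)" for s t
      unfolding h_def S_def
      by (subst Bcontfun_compact[OF K]) (auto intro!: continuous_intros)
    have sum_h: "(\<Sum>s\<in>D. h s) = shrink e f"
    proof (rule bcontfun_eqI)
      fix t
      have "(\<Sum>s\<in>D. h s) t = max 0 (f t - e) * S t / max (1/2) (S t)"
        by (simp add: bc_sum_apply h S_def sum_distrib_left sum_divide_distrib)
      also have "\<dots> = shrink e f t"
      proof (cases "t \<in> C")
        case True
        then show ?thesis using S_big[OF True] by (simp add: max_def)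
      next
        case False
        then have "max 0 (f t - e) = 0" by (simp add: C_def)
        then show ?thesis by simp
      qed
      finally show "(\<Sum>s\<in>D. h s) t = shrink e f t" .
    qed
    have h_nonneg: "0 \<le> h s t" if "s \<in> D" for s t
      using g_nonneg[OF that] by (auto simp: h intro!: divide_nonneg_pos mult_nonneg_nonneg)
    define H where "H j = (\<Sum>s\<in>{s\<in>D. i s = j}. h s)" for j
    have H: "H j \<in> subordinate (U j)" for j
      unfolding subordinate_def
    proof (intro CollectI allI conjI impI)
      fix t
      have H_eq: "H j t = (\<Sum>s\<in>{s\<in>D. i s = j}. h s t)" by (simp add: H_def bc_sum_apply)
      show "0 \<le> H j t" unfolding H_eq using h_nonneg by (intro sum_nonneg) auto
      have "H j t \<le> (\<Sum>s\<in>D. h s t)"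
        unfolding H_eq using D h_nonneg by (intro sum_mono2) auto
      also have "\<dots> = shrink e f t" using sum_h bc_sum_apply by metis
      also have "\<dots> \<le> 1" using subordinateD(2)[OF f, of t] e by simp
      finally show "H j t \<le> 1" .
      show "H j t = 0" if "t \<notin> U j"
        unfolding H_eq
      proof (intro sum.neutral ballI)
        fix s assume "s \<in> {s\<in>D. i s = j}"
        then have "g s \<in> subordinate (U j)" using ig(1) D by blast
        then show "h s t = 0" using subordinateD(3)[OF _ that] by (simp add: h)
      qed
    qed
    have "shrink e f = (\<Sum>j\<in>i ` D. H j)"
      unfolding sum_h[symmetric] H_def using D(2) by (rule sum.image_gen)
    then have "L (shrink e f) = (\<Sum>j\<in>i ` D. L (H j))"
      by (simp add: linear_sum[OF lin])
    also have "ennreal \<dots> = (\<Sum>j\<in>i ` D. ennreal (L (H j)))"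
      using H by (intro sum_ennreal[symmetric] functional_nonneg) (auto dest: subordinateD)
    also have "\<dots> \<le> (\<Sum>j\<in>i ` D. open_content L (U j))"
      by (intro sum_mono functional_le_open_content H)
    also have "\<dots> \<le> (\<Sum>j. open_content L (U j))"
      using D by (intro sum_le_suminf) auto
    finally show ?thesis .
  qed
  then show "ennreal (L f) \<le> (\<Sum>i. open_content L (U i))"
    using functional_le_if_shrink_le[of f 0] by simp
qed

lemma functional_outer_open: "open U \<Longrightarrow> functional_outer L U = open_content L U"
  unfolding functional_outer_def
  by (intro antisym INF_lower INF_greatest open_content_mono) auto

lemma functional_outer_mono: "A \<subseteq> B \<Longrightarrow> functional_outer L A \<le> functional_outer L B"
  unfolding functional_outer_def by (intro INF_superset_mono) auto

lemma functional_outer_less_top: "functional_outer L A < top"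
proof -
  have "functional_outer L A \<le> functional_outer L UNIV" by (rule functional_outer_mono) simp
  also have "\<dots> < top" by (simp add: functional_outer_open open_content_UNIV)
  finally show ?thesis .
qed

lemma functional_outer_UN_le:
  "functional_outer L (\<Union>i::nat. A i) \<le> (\<Sum>i. functional_outer L (A i))"
proof (rule ennreal_le_epsilon)
  fix e :: real assume e: "0 < e"
  have "\<exists>U. open U \<and> A n \<subseteq> U \<and> open_content L U \<le> functional_outer L (A n) + ennreal (e * (1/2) ^ Suc n)" for n
  proof -
    have "functional_outer L (A n) < functional_outer L (A n) + ennreal (e * (1/2) ^ Suc n)"
      using functional_outer_less_top[of "A n"] e
      by (subst add_0_right[symmetric], subst ennreal_add_left_cancel_less) auto
    then have "(INF U\<in>{U. open U \<and> A n \<subseteq> U}. open_content L U) < functional_outer L (A n) + ennreal (e * (1/2) ^ Suc n)"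
      by (simp only: functional_outer_def[symmetric])
    then show ?thesis
      unfolding INF_less_iff by (auto intro: less_imp_le)
  qed
  then obtain U where U: "\<And>n. open (U n)" "\<And>n. A n \<subseteq> U n"
      "\<And>n. open_content L (U n) \<le> functional_outer L (A n) + ennreal (e * (1/2) ^ Suc n)"
    by metis
  have "functional_outer L (\<Union>i. A i) \<le> functional_outer L (\<Union>i. U i)"
    using U(2) by (intro functional_outer_mono) blast
  also have "\<dots> = open_content L (\<Union>i. U i)"
    using U(1) by (intro functional_outer_open) blast
  also have "\<dots> \<le> (\<Sum>i. open_content L (U i))"
    by (intro open_content_UN_le U)
  also have "\<dots> \<le> (\<Sum>n. functional_outer L (A n) + ennreal (e * (1/2) ^ Suc n))"
    by (intro suminf_le U) auto
  also have "\<dots> = (\<Sum>n. functional_outer L (A n)) + (\<Sum>n. ennreal e * ennreal ((1/2) ^ Suc n))"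
    using e by (subst suminf_add[symmetric])
      (auto simp del: ennreal_suminf_cmult simp add: ennreal_mult[symmetric])
  also have "\<dots> = (\<Sum>n. functional_outer L (A n)) + e"
    unfolding ennreal_suminf_cmult
    by (subst suminf_ennreal_eq[OF zero_le_power power_half_series]) auto
  finally show "functional_outer L (\<Union>i. A i) \<le> (\<Sum>i. functional_outer L (A i)) + e" .
qed

lemma outer_measure_space_functional_outer: "outer_measure_space UNIV (functional_outer L)"
  unfolding outer_measure_space_def positive_def increasing_def countably_subadditive_def
  using functional_outer_mono functional_outer_UN_le functional_outer_open[of "{}"] open_content_empty
  by auto

text \<open>Let \<open>f\<close> be subordinate to \<open>V \<inter> U\<close>. After cutting it off at height \<open>e\<close> it vanishes on
  \<open>W = {t \<in> V. f t < e}\<close>, an open set that contains \<open>V - U\<close>; hence it can be added to any function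
  subordinate to \<open>W\<close>, and the sum is subordinate to \<open>V\<close>.\<close>

lemma open_caratheodory_open:
  assumes "open U" "open V"
  shows "open_content L (V \<inter> U) + functional_outer L (V - U) \<le> open_content L V"
proof -
  have "ennreal (L f) + functional_outer L (V - U) \<le> open_content L V" if f: "f \<in> subordinate (V \<inter> U)" for f
  proof -
    have approx: "ennreal (L (shrink e f)) + functional_outer L (V - U) \<le> open_content L V" if e: "0 < e" for e
    proof -
      define W where "W = V \<inter> {t. f t < e}"
      have W: "open W"
        unfolding W_def using assms by (intro open_Int open_Collect_less continuous_intros) auto
      have "V - U \<subseteq> W"
        using subordinateD(3)[OF f] e by (auto simp: W_def)
      then have "functional_outer L (V - U) \<le> open_content L W"
        using functional_outer_mono[of "V - U" W] functional_outer_open[OF W] by simp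
      then have "ennreal (L (shrink e f)) + functional_outer L (V - U)
          \<le> ennreal (L (shrink e f)) + open_content L W"
        by (rule add_left_mono)
      also have "\<dots> = (SUP g\<in>subordinate W. ennreal (L (shrink e f)) + ennreal (L g))"
        unfolding open_content_def by (rule ennreal_SUP_add_right) (use zero_subordinate in auto)
      also have "\<dots> \<le> open_content L V"
      proof (rule SUP_least)
        fix g assume g: "g \<in> subordinate W"
        have "0 \<le> L (shrink e f)" "0 \<le> L g"
          using subordinateD(1)[OF g] by (auto intro!: functional_nonneg)
        then have "ennreal (L (shrink e f)) + ennreal (L g) = ennreal (L (shrink e f + g))"
          by (simp add: linear_add[OF lin] ennreal_plus)
        also have "\<dots> \<le> open_content L V"
        proof (intro functional_le_open_content, unfold subordinate_def, intro CollectI allI conjI impI)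
          fix t
          show "0 \<le> (shrink e f + g) t" using subordinateD(1)[OF g, of t] by simp
          show "(shrink e f + g) t \<le> 1"
          proof (cases "t \<in> W")
            case True
            then have "shrink e f t = 0" by (simp add: W_def)
            then show ?thesis using subordinateD(2)[OF g, of t] by simp
          next
            case False
            then show ?thesis using subordinateD(3)[OF g False] subordinateD(2)[OF f, of t] e by simp
          qed
          show "(shrink e f + g) t = 0" if "t \<notin> V"
            using that subordinateD(3)[OF f, of t] subordinateD(3)[OF g, of t] e by (simp add: W_def)
        qed
        finally show "ennreal (L (shrink e f)) + ennreal (L g) \<le> open_content L V" .
      qed
      finally show ?thesis .
    qed
    then show ?thesis by (rule functional_le_if_shrink_le)
  qed
  then have "(SUP f\<in>subordinate (V \<inter> U). ennreal (L f) + functional_outer L (V - U)) \<le> open_content L V"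
    by (rule SUP_least)
  then show ?thesis
    unfolding open_content_def[of L "V \<inter> U"] using zero_subordinate
    by (subst ennreal_SUP_add_left[symmetric]) auto
qed

lemma open_in_lambda_system:
  assumes "open U"
  shows "U \<in> lambda_system UNIV UNIV (functional_outer L)"
proof -
  have "functional_outer L (A \<inter> U) + functional_outer L (A - U) = functional_outer L A" for A
  proof (rule antisym)
    show "functional_outer L (A \<inter> U) + functional_outer L (A - U) \<le> functional_outer L A"
      unfolding functional_outer_def[of L A]
    proof (rule INF_greatest)
      fix V assume "V \<in> {V. open V \<and> A \<subseteq> V}"
      then have V: "open V" "A \<subseteq> V" by auto
      have "functional_outer L (A \<inter> U) + functional_outer L (A - U)
          \<le> functional_outer L (V \<inter> U) + functional_outer L (V - U)"
        using V by (intro add_mono functional_outer_mono) auto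
      also have "\<dots> \<le> open_content L V"
        using V assms open_caratheodory_open by (simp add: functional_outer_open open_Int)
      finally show "functional_outer L (A \<inter> U) + functional_outer L (A - U) \<le> open_content L V" .
    qed
    have "functional_outer L A \<le> functional_outer L (\<Union>i. binaryset (A \<inter> U) (A - U) i)"
      by (rule functional_outer_mono) (auto simp: UN_binaryset_eq)
    also have "\<dots> \<le> (\<Sum>i. functional_outer L (binaryset (A \<inter> U) (A - U) i))"
      by (rule functional_outer_UN_le)
    also have "\<dots> = functional_outer L (A \<inter> U) + functional_outer L (A - U)"
      using functional_outer_open[of "{}"] open_content_empty by (intro suminf_binaryset_eq) simp
    finally show "functional_outer L A \<le> functional_outer L (A \<inter> U) + functional_outer L (A - U)" .
  qed
  moreover have "algebra UNIV (UNIV :: 'k set set)"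
    using algebra_Pow[of "UNIV :: 'k set"] by simp
  ultimately show ?thesis
    by (simp add: algebra.lambda_system_eq)
qed

text \<open>The part of the Riesz representation theorem that carries strict positivity of the functional
  over to the measure.\<close>

theorem positive_functional_measure:
  obtains M :: "'k measure" where "sets M = sets borel" "finite_measure M"
    "\<forall>U. open U \<longrightarrow> (\<forall>f\<in>subordinate U. L f \<le> measure M U)"
proof
  define S where "S = lambda_system UNIV UNIV (functional_outer L)"
  have "sigma_algebra UNIV (UNIV :: 'k set set)"
    using sigma_algebra_Pow[of "UNIV :: 'k set"] by simp
  then have ms: "measure_space UNIV S (functional_outer L)"
    unfolding S_def by (rule sigma_algebra.caratheodory_lemma[OF _ outer_measure_space_functional_outer])
  then interpret S: sigma_algebra UNIV S by (simp add: measure_space_def)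
  have borel_S: "sets (borel :: 'k measure) \<subseteq> S"
    unfolding sets_borel using open_in_lambda_system
    by (intro S.sigma_sets_subset) (auto simp: S_def)
  define M where "M = measure_of UNIV (sets (borel :: 'k measure)) (functional_outer L)"
  have sub: "sets (borel :: 'k measure) \<subseteq> Pow UNIV" by simp
  show sets: "sets M = sets borel"
    unfolding M_def using sets.sigma_sets_eq[of "borel :: 'k measure"] by (simp add: sets_measure_of[OF sub])
  have emeasure: "emeasure M A = functional_outer L A" if "A \<in> sets borel" for A
  proof (rule emeasure_measure_of[OF M_def sub])
    show "positive (sets M) (functional_outer L)"
      using ms by (simp add: measure_space_def positive_def)
    show "countably_additive (sets M) (functional_outer L)"
    proof (rule countably_additiveI)
      fix A :: "nat \<Rightarrow> 'k set"
      assume A: "range A \<subseteq> sets M" "disjoint_family A"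
      then have "range A \<subseteq> S" using borel_S sets by blast
      moreover from this have "(\<Union>i. A i) \<in> S" by blast
      ultimately show "(\<Sum>i. functional_outer L (A i)) = functional_outer L (\<Union>i. A i)"
        using A(2) ms by (simp add: measure_space_def countably_additive_def)
    qed
    show "A \<in> sets M" using that sets by simp
  qed
  have space: "space M = UNIV"
    using sets_eq_imp_space_eq[OF sets] by simp
  show fin: "finite_measure M"
  proof
    show "emeasure M (space M) \<noteq> \<infinity>"
      using emeasure[of UNIV] functional_outer_less_top[of UNIV] by (auto simp: space)
  qed
  show "\<forall>U. open U \<longrightarrow> (\<forall>f\<in>subordinate U. L f \<le> measure M U)"
  proof (intro allI impI ballI)
    fix U :: "'k set" and f assume U: "open U" and f: "f \<in> subordinate U"
    have "ennreal (L f) \<le> emeasure M U"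
      using functional_le_open_content[OF f] emeasure[of U] functional_outer_open[OF U] U by simp
    then show "L f \<le> measure M U"
      by (simp add: finite_measure.emeasure_eq_measure[OF fin] ennreal_le_iff)
  qed
qed

end

section \<open>The equivalence\<close>

theorem theorem2:
  assumes "compact (UNIV :: 'k::t2_space set)"
  shows "(\<exists>N :: ('k \<Rightarrow>\<^sub>C real) \<Rightarrow> real. equivalent_norm N \<and> URED N) \<longleftrightarrow>
         supports_strictly_positive_measure TYPE('k)"
proof
  assume "\<exists>N :: ('k \<Rightarrow>\<^sub>C real) \<Rightarrow> real. equivalent_norm N \<and> URED N"
  then obtain N :: "('k \<Rightarrow>\<^sub>C real) \<Rightarrow> real" where N: "equivalent_norm N" "URED N"
    by blast
  obtain L :: "('k \<Rightarrow>\<^sub>C real) \<Rightarrow> real" where L: "linear L"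
    and pos: "\<forall>g. (\<forall>t. 0 \<le> apply_bcontfun g t) \<longrightarrow> 0 \<le> L g"
    and strict: "\<forall>g. (\<forall>t. 0 \<le> apply_bcontfun g t) \<longrightarrow> g \<noteq> 0 \<longrightarrow> 0 < L g"
    by (rule URED_imp_strictly_positive_functional[OF N])
  obtain M :: "'k measure" where M: "sets M = sets borel" "finite_measure M"
    and le: "\<forall>U. open U \<longrightarrow> (\<forall>f\<in>subordinate U. L f \<le> measure M U)"
    by (rule positive_functional_measure[OF assms L pos])
  have "0 < measure M G" if "open G" "G \<noteq> {}" for G
  proof -
    obtain s where "s \<in> G" using \<open>G \<noteq> {}\<close> by blast
    then obtain g where g: "g \<in> subordinate G" "g s = 1"
      by (rule compact_t2_bump[OF assms \<open>open G\<close>])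
    then have "g \<noteq> 0" "\<forall>t. 0 \<le> apply_bcontfun g t"
      by (auto dest: subordinateD)
    with strict have "0 < L g" by blast
    also have "\<dots> \<le> measure M G" using le \<open>open G\<close> g(1) by blast
    finally show ?thesis .
  qed
  with M show "supports_strictly_positive_measure TYPE('k)"
    unfolding supports_strictly_positive_measure_def by blast
next
  assume "supports_strictly_positive_measure TYPE('k)"
  then obtain M :: "'k measure" where M: "sets M = sets borel" "finite_measure M"
    and strict: "\<And>G. open G \<Longrightarrow> G \<noteq> {} \<Longrightarrow> 0 < measure M G"
    unfolding supports_strictly_positive_measure_def by blast
  have "URED (sup_L2_norm M)"
    by (rule URED_sup_L2[OF M]) (rule strict)
  with equivalent_norm_sup_L2[OF M] show "\<exists>N :: ('k \<Rightarrow>\<^sub>C real) \<Rightarrow> real. equivalent_norm N \<and> URED N"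
    by blast
qed

end
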